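(* Let $D\ge 1$ be an integer, let $b_1,\dots,b_{2D}\in\mathbb R$, and for $j=1,2$ let $$\Phi_j(x)=b_1\frac{B_j(x)}{j}+b_2\frac{B_{j+1}(x)}{j+1}+\cdots+b_{2D}\frac{B_{2D+j-1}(x)}{2D+j-1}.$$ If $\Phi_j(0)=\Phi_j\left(\frac1D\right)=\cdots=\Phi_j\left(\frac{D-1}{D}\right)=0$ for $j=1,2$, then $\Phi_1=\Phi_2=0$. Consequently, $\Delta_{2,D}\ne 0$.
   Context: The Bernoulli polynomials $B_n(x)$ are defined by $\frac{ze^{xz}}{e^z-1}=\sum_{n\ge 0}B_n(x)\frac{z^n}{n!}$. For integers $r,D\ge1$, $\Delta_{r,D}$ is the determinant of the $rD\times rD$ matrix whose rows are indexed by $n=0,1,\dots,rD-1$ (in this order), and whose $(mD+v)$-th column ($0\le m\le r-1$, $1\le v\le D$) has in row $n$ the entry $D^{n+m}\,\frac{B_{n+m+1}(v/D)}{n+m+1}$. *)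

theory Defs
  imports
    Complex_Main
    "HOL-Computational_Algebra.Formal_Power_Series"
    "Jordan_Normal_Form.Determinant"
begin

(* The series z e^(xz) / (e^z - 1) in z, for fixed real x.  The divisor has no constant term;
   division of formal power series over a field cancels the common factor z. *)
definition bernoulli_gf :: "real \<Rightarrow> real fps" where
  "bernoulli_gf x = fps_X * fps_exp x / (fps_exp 1 - 1)"

definition bernpoly :: "nat \<Rightarrow> real \<Rightarrow> real" where
  "bernpoly n x = fact n * fps_nth (bernoulli_gf x) n"

(* The division above is exact. *)
lemma bernoulli_gf_mult: "bernoulli_gf x * (fps_exp 1 - 1) = fps_X * fps_exp x"
proof -
  have nz: "fps_nth (fps_exp (1::real) - 1) 1 \<noteq> 0" by simp
  hence ne: "fps_exp (1::real) - 1 \<noteq> 0" by (metis fps_zero_nth)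
  have "subdegree (fps_exp (1::real) - 1) \<le> 1"
    using nz by (rule subdegree_leI)
  also have "1 \<le> subdegree (fps_X * fps_exp x)"
    by (rule subdegree_geI) (auto simp: fps_X_mult_nth fps_eq_iff intro!: exI[of _ 1])
  finally have "(fps_exp (1::real) - 1) dvd fps_X * fps_exp x"
    using ne by (simp add: fps_dvd_iff)
  thus ?thesis unfolding bernoulli_gf_def by simp
qed

definition Phi :: "nat \<Rightarrow> (nat \<Rightarrow> real) \<Rightarrow> nat \<Rightarrow> real \<Rightarrow> real" where
  "Phi D b j x = (\<Sum>k = 1..2 * D. b k * (bernpoly (k + j - 1) x / real (k + j - 1)))"

(* Columns are numbered from 0 here: column c = m D + v - 1 with 0 <= m < r, 1 <= v <= D
   is the column called m D + v when counting from 1. *)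
definition Delta_mat :: "nat \<Rightarrow> nat \<Rightarrow> real mat" where
  "Delta_mat r D = mat (r * D) (r * D)
     (\<lambda>(n, c). let m = c div D; v = c mod D + 1
               in real D ^ (n + m) * (bernpoly (n + m + 1) (real v / real D) / real (n + m + 1)))"

definition Delta :: "nat \<Rightarrow> nat \<Rightarrow> real" where
  "Delta r D = det (Delta_mat r D)"

end

theory Submission
  imports Defs "HOL-Analysis.Equivalence_Lebesgue_Henstock_Integration"
begin

text \<open>Rescale by \<open>t = D x\<close> and put \<open>P(t) = t (t - 1) \<cdots> (t - D + 1)\<close>. Both functions vanish at the
zeros of \<open>P\<close>, so \<open>\<Phi>\<^sub>1 = P A\<close> and \<open>D \<Phi>\<^sub>2 = P C\<close>. The difference equation of the Bernoulli polynomials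
says that the increment of \<open>D \<Phi>\<^sub>2\<close> over a step \<open>D\<close> is \<open>t\<close> times that of \<open>\<Phi>\<^sub>1\<close>. As \<open>P(t)\<close> and
\<open>P(t + D)\<close> are coprime, \<open>C - t A = P(t + D) E\<close> with \<open>E = e\<^sub>0 + e\<^sub>1 t\<close> by degrees, and everything is
expressed by \<open>N(t) = P(t) P(t + D) E(t)\<close>:
\<open>D \<Phi>\<^sub>1 = N(t - D) - N(t)\<close> and \<open>D (D \<Phi>\<^sub>2) = t N(t - D) - (t - D) N(t)\<close>.
Here \<open>P(t) P(t + D) = (t + D) R(t)\<close> with \<open>R\<close> odd, so the two conditions that the integrals over a
period vanish become \<open>\<integral> (D e\<^sub>0 + e\<^sub>1 t\<^sup>2) R = 0\<close> and \<open>(e\<^sub>0 + D e\<^sub>1) \<integral> t (D - t) R = 0\<close> over \<open>[0, D]\<close>.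
They force \<open>e\<^sub>0 = e\<^sub>1 = 0\<close>, because \<open>\<integral> t (D - t) R\<close> and \<open>\<integral> (D\<^sup>2 - t\<^sup>2) R\<close> are nonzero: on
consecutive unit intervals the integrands alternate in sign and grow in absolute value.

A vanishing determinant would give a nontrivial linear relation between the rows, that is,
coefficients \<open>b\<^sub>k\<close>, since \<open>B\<^sub>n(1 - x) = (-1)\<^sup>n B\<^sub>n(x)\<close> maps the nodes \<open>1/D, \<dots>, D/D\<close> of the matrix
to \<open>0, \<dots>, (D - 1)/D\<close>.\<close>

subsection \<open>Bernoulli polynomials\<close>

text \<open>Multiplied by e^z - 1, both sides become z e^(xz), and this nonzero factor cancels. The
  dependence on x is thereby isolated in an exponential.\<close>

lemma bernoulli_gf_exp: "bernoulli_gf x = bernoulli_gf 0 * fps_exp x"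
proof -
  have ne: "fps_exp (1::real) - 1 \<noteq> 0"
    by (metis fps_exp_eq_1_iff eq_iff_diff_eq_0 zero_neq_one)
  have "bernoulli_gf x * (fps_exp 1 - 1) = (bernoulli_gf 0 * fps_exp x) * (fps_exp 1 - 1)"
    using bernoulli_gf_mult[of x] bernoulli_gf_mult[of 0] by (simp add: mult.assoc mult.left_commute mult.commute)
  then show ?thesis using ne by simp
qed

text \<open>Substitute -z for z in the defining identity and multiply by e^z: the factor e^(-z) - 1
  turns into -(e^z - 1), and its sign cancels that of -z.\<close>

lemma bernoulli_gf_uminus: "bernoulli_gf (1 - x) = bernoulli_gf x oo (fps_const (-1) * fps_X)"
proof -
  let ?m = "fps_const (-1) * fps_X :: real fps"
  have ne: "fps_exp (1::real) - 1 \<noteq> 0"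
    by (metis fps_exp_eq_1_iff eq_iff_diff_eq_0 zero_neq_one)
  have e: "fps_exp c oo ?m = fps_exp (- c)" for c :: real
    using fps_exp_compose_linear[of c "-1"] by simp
  have "(bernoulli_gf x * (fps_exp 1 - 1)) oo ?m = (fps_X * fps_exp x) oo ?m"
    by (simp only: bernoulli_gf_mult)
  then have "(bernoulli_gf x oo ?m) * (fps_exp (- 1) - 1) = ?m * fps_exp (- x)"
    by (simp add: fps_compose_mult_distrib fps_compose_sub_distrib e)
  then have "(bernoulli_gf x oo ?m) * ((fps_exp (- 1) - 1) * fps_exp 1) = ?m * (fps_exp (- x) * fps_exp 1)"
    by (simp only: mult.assoc[symmetric])
  also have "(fps_exp (- 1) - 1) * fps_exp 1 = - (fps_exp (1::real) - 1)"
    by (simp add: algebra_simps fps_exp_add_mult[symmetric])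
  also have "fps_exp (- x) * fps_exp 1 = fps_exp (1 - x)"
    by (simp add: fps_exp_add_mult[symmetric])
  finally have "(bernoulli_gf x oo ?m) * (fps_exp 1 - 1) = fps_X * fps_exp (1 - x)"
    by (simp only: mult_minus_right minus_equation_iff[of _ "_ * _"] fps_const_neg[symmetric] fps_const_1_eq_1 mult_minus_left mult_1 neg_equal_iff_equal)
  then show ?thesis
    using bernoulli_gf_mult[of "1 - x"] ne by (metis mult_right_cancel)
qed

lemma bernpoly_reflect: "bernpoly n (1 - x) = (-1) ^ n * bernpoly n x"
  unfolding bernpoly_def bernoulli_gf_uminus by (simp add: fps_compose_linear)

lemma bernpoly_diff: "bernpoly (Suc n) (x + 1) - bernpoly (Suc n) x = real (Suc n) * x ^ n"
proof -
  \<comment> \<open>A unit step in x produces the factor e^z - 1, exactly the divisor of the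
    generating function.\<close>
  have "bernoulli_gf (x + 1) - bernoulli_gf x = bernoulli_gf x * (fps_exp 1 - 1)"
    unfolding bernoulli_gf_exp[of "x + 1"] bernoulli_gf_exp[of x]
    by (simp add: algebra_simps fps_exp_add_mult)
  then have "bernoulli_gf (x + 1) - bernoulli_gf x = fps_X * fps_exp x"
    by (simp add: bernoulli_gf_mult)
  from arg_cong[where f = "\<lambda>F. fps_nth F (Suc n)", OF this]
  have "fps_nth (bernoulli_gf (x + 1)) (Suc n) - fps_nth (bernoulli_gf x) (Suc n) = x ^ n / fact n"
    by simp
  then show ?thesis
    unfolding bernpoly_def right_diff_distrib[symmetric] by simp
qed

text \<open>The Cauchy product of the series at 0 with e^(xz), kept as a formal polynomial so that
  degrees and \<open>pderiv\<close> are available.\<close>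

definition bern :: "nat \<Rightarrow> real poly" where
  "bern n = (\<Sum>k\<le>n. monom (real (n choose k) * bernpoly (n - k) 0) k)"

lemma poly_bern: "poly (bern n) x = bernpoly n x"
proof -
  have "bernpoly n x = fact n * (\<Sum>k=0..n. fps_nth (fps_exp x) k * fps_nth (bernoulli_gf 0) (n - k))"
    unfolding bernpoly_def by (subst bernoulli_gf_exp) (simp only: mult.commute[of "bernoulli_gf 0"] fps_mult_nth)
  also have "\<dots> = (\<Sum>k\<le>n. real (n choose k) * bernpoly (n - k) 0 * x ^ k)"
    unfolding sum_distrib_left atLeast0AtMost bernpoly_def
    by (intro sum.cong refl) (simp add: binomial_fact)
  finally show ?thesis by (simp add: bern_def poly_sum poly_monom)
qed

lemma degree_bern: "degree (bern n) \<le> n"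
  unfolding bern_def by (rule degree_sum_le) (auto intro: order.trans[OF degree_monom_le])

lemma pderiv_bern: "pderiv (bern (Suc n)) = smult (real (Suc n)) (bern n)"
proof -
  have "pderiv (bern (Suc n)) = (\<Sum>k\<le>n. monom (real (Suc k) * (real (Suc n choose Suc k) * bernpoly (n - k) 0)) k)"
    unfolding bern_def by (subst sum.atMost_Suc_shift) (simp add: pderiv_add higher_pderiv_sum[of 1, simplified] pderiv_monom)
  also have "\<dots> = smult (real (Suc n)) (bern n)"
  proof (rule poly_eqI)
    fix i
    have "real (Suc i) * real (Suc n choose Suc i) = real (Suc n) * real (n choose i)"
      by (metis Suc_times_binomial of_nat_mult)
    then show "coeff (\<Sum>k\<le>n. monom (real (Suc k) * (real (Suc n choose Suc k) * bernpoly (n - k) 0)) k) i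
        = coeff (smult (real (Suc n)) (bern n)) i"
      by (simp add: bern_def coeff_sum mult.assoc[symmetric] del: of_nat_Suc binomial_Suc_Suc)
  qed
  finally show ?thesis .
qed

subsection \<open>Alternating integrals of odd products\<close>

text \<open>Each new term outweighs the partial sum before it, so a partial sum keeps the sign of
  its last term and does not exceed it in absolute value.\<close>

lemma sum_alternating_growing_nonzero:
  fixes a :: "nat \<Rightarrow> real"
  assumes "a 0 \<noteq> 0" and "\<And>k. Suc k < n \<Longrightarrow> a k * a (Suc k) < 0"
    and "\<And>k. Suc k < n \<Longrightarrow> \<bar>a k\<bar> < \<bar>a (Suc k)\<bar>" and "0 < n"
  shows "(\<Sum>k<n. a k) \<noteq> 0"
proof -
  have "0 < a k * (\<Sum>i\<le>k. a i) \<and> \<bar>\<Sum>i\<le>k. a i\<bar> \<le> \<bar>a k\<bar>" if "k < n" for k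
    using that
  proof (induction k)
    case 0
    then show ?case using assms(1) by (auto simp: zero_less_mult_iff)
  next
    case (Suc k)
    then show ?case using assms(2)[of k] assms(3)[of k]
      by (auto simp: zero_less_mult_iff mult_less_0_iff)
  qed
  from this[of "n - 1"] show ?thesis
    using assms(4) by (cases n) (auto simp: lessThan_Suc_atMost)
qed

section \<open>Reflecting and splitting integrals over [0, b]\<close>

lemma integral_reflect_interval:
  fixes h :: "real \<Rightarrow> real"
  assumes "continuous_on {0..b} h" "0 \<le> b"
  shows "integral {0..b} (\<lambda>t. h (b - t)) = integral {0..b} h"
proof -
  have "(h has_integral integral {0..b} h) (cbox 0 b)"
    using assms integrable_continuous_interval by (simp add: has_integral_integral[symmetric])
  from has_integral_affinity[OF this, of "-1" b]
  have "((\<lambda>x. h (b - x)) has_integral integral {0..b} h)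
      ((\<lambda>x. (1 / (- 1)) *\<^sub>R x + - ((1 / (- 1)) *\<^sub>R b)) ` cbox 0 b)"
    by simp
  moreover have "(\<lambda>x. (1 / (- 1)) *\<^sub>R x + - ((1 / (- 1)) *\<^sub>R b)) ` cbox 0 b = (\<lambda>x. b - x) ` {0..b}"
    by (intro image_cong) auto
  ultimately have "((\<lambda>x. h (b - x)) has_integral integral {0..b} h) {0..b}"
    by (simp add: image_diff_atLeastAtMost)
  then show ?thesis by (rule integral_unique)
qed

lemma integral_sum_unit_intervals:
  fixes h :: "real \<Rightarrow> real"
  assumes "continuous_on UNIV h"
  shows "integral {0..real n} h = (\<Sum>k<n. integral {real k..real k + 1} h)"
proof (induction n)
  case (Suc n)
  have "integral {0..real n} h + integral {real n..real (Suc n)} h = integral {0..real (Suc n)} h"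
    using assms by (intro integral_combine integrable_continuous_interval) (auto intro: continuous_on_subset)
  then show ?case using Suc by (simp add: add.commute)
qed simp

text \<open>For D > 0 this is the product of t - i over all integers i with -D < i < D, with i and
  -i paired to make oddness visible.\<close>

definition central_prod :: "nat \<Rightarrow> real \<Rightarrow> real" where
  "central_prod D t = t * (\<Prod>i=1..<D. t\<^sup>2 - (real i)\<^sup>2)"

lemma central_prod_Suc:
  "0 < D \<Longrightarrow> central_prod (Suc D) t = central_prod D t * (t\<^sup>2 - (real D)\<^sup>2)"
  unfolding central_prod_def by (simp add: prod.atLeastLessThan_Suc)

lemma central_prod_uminus: "central_prod D (- t) = - central_prod D t"
  unfolding central_prod_def by simp

text \<open>A unit step moves the window of zeros by one: it gains the zero -D and loses D - 1.
  Multiplying out avoids a division at t = D - 1.\<close>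

lemma central_prod_shift:
  assumes "0 < D"
  shows "central_prod D (t + 1) * (t + 1 - real D) = central_prod D t * (t + real D)"
  using assms
proof (induction D rule: nat_induct_non_zero)
  case (Suc D)
  have "central_prod (Suc D) (t + 1) * (t + 1 - real (Suc D))
      = (central_prod D (t + 1) * (t + 1 - real D)) * ((t + 1 + real D) * (t - real D))"
    using Suc.hyps by (simp add: central_prod_Suc power2_eq_square algebra_simps)
  also have "\<dots> = central_prod (Suc D) t * (t + real (Suc D))"
    unfolding Suc.IH using Suc.hyps by (simp add: central_prod_Suc power2_eq_square algebra_simps)
  finally show ?case .
qed (simp add: central_prod_def algebra_simps)

text \<open>The zeros 0, ..., D - 1 and -D, ..., -1 together are symmetric about 0 except for -D,
  which the factor t + D splits off.\<close>

lemma falling_prod_mult_shift: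
  assumes "0 < D"
  shows "(\<Prod>i<D. t - real i) * (\<Prod>i<D. t + real D - real i) = (t + real D) * central_prod D t"
  using assms
proof (induction D rule: nat_induct_non_zero)
  case (Suc D)
  have "(\<Prod>i<Suc D. t + real (Suc D) - real i) = (t + real (Suc D)) * (\<Prod>i<D. t + real D - real i)"
    by (subst prod.lessThan_Suc_shift) (simp add: algebra_simps)
  then have "(\<Prod>i<Suc D. t - real i) * (\<Prod>i<Suc D. t + real (Suc D) - real i)
      = ((\<Prod>i<D. t - real i) * (\<Prod>i<D. t + real D - real i)) * ((t - real D) * (t + real (Suc D)))"
    by (simp add: mult_ac)
  also have "\<dots> = (t + real (Suc D)) * central_prod (Suc D) t"
    unfolding Suc.IH using Suc.hyps by (simp add: central_prod_Suc power2_eq_square algebra_simps)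
  finally show ?case .
qed (simp add: central_prod_def algebra_simps)

text \<open>On (0, 1) exactly the D - 1 quadratic factors are negative. Each further unit step flips
  the sign, since in the shift relation t + k + 1 - D is negative and t + k + D is positive.\<close>

lemma central_prod_sign:
  assumes "k < D" "0 < t" "t < 1"
  shows "0 < (-1) ^ (D + k + 1) * central_prod D (t + real k)"
  using assms(1)
proof (induction k)
  case 0
  have "(-1) ^ (D + 1) * central_prod D t = t * (\<Prod>i=1..<D. (real i)\<^sup>2 - t\<^sup>2)"
  proof -
    have "(\<Prod>i=1..<D. (real i)\<^sup>2 - t\<^sup>2) = (\<Prod>i=1..<D. (-1) * (t\<^sup>2 - (real i)\<^sup>2))"
      by (intro prod.cong) auto
    also have "\<dots> = (-1) ^ (D - 1) * (\<Prod>i=1..<D. t\<^sup>2 - (real i)\<^sup>2)"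
      by (subst prod.distrib) simp
    also have "(-1::real) ^ (D - 1) = (-1) ^ (D + 1)"
      using 0 by (cases D) auto
    finally show ?thesis by (simp add: central_prod_def)
  qed
  moreover have "0 < (\<Prod>i=1..<D. (real i)\<^sup>2 - t\<^sup>2)"
  proof (rule prod_pos)
    fix i assume "i \<in> {1..<D}"
    then have "1 \<le> real i" by simp
    then have "t < real i" using assms(3) by linarith
    then show "0 < (real i)\<^sup>2 - t\<^sup>2" using assms(2) by (simp add: power_strict_mono)
  qed
  ultimately show ?case using assms by simp
next
  case (Suc k)
  let ?c = "\<lambda>x. central_prod D x"
  have le: "real (Suc k) + 1 \<le> real D" using Suc.prems by linarith
  have "?c (t + real k + 1) * (t + real k + 1 - real D) = ?c (t + real k) * (t + real k + real D)"
    using Suc.prems by (intro central_prod_shift) simp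
  then have "((-1) ^ (D + Suc k + 1) * ?c (t + real (Suc k))) * (real D - (t + real k + 1))
      = ((-1) ^ (D + k + 1) * ?c (t + real k)) * (t + real k + real D)"
    by (simp add: algebra_simps)
  moreover have "0 < ((-1) ^ (D + k + 1) * ?c (t + real k)) * (t + real k + real D)"
    by (rule mult_pos_pos) (use Suc.IH Suc.prems assms(2) in auto)
  moreover have "0 < real D - (t + real k + 1)" using le assms(3) by simp
  ultimately show ?case by (metis zero_less_mult_pos2)
qed

text \<open>By the shift relation, \<open>grow\<close> says that the absolute value of the weighted
  product increases under a unit step. The integrals over unit intervals then alternate in sign and
  grow.\<close>

lemma integral_weight_central_prod_nonzero:
  assumes "0 < D" and cont: "continuous_on UNIV w"
    and pos: "\<And>t. 0 < t \<Longrightarrow> t < real D \<Longrightarrow> 0 < w t"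
    and grow: "\<And>t. 0 < t \<Longrightarrow> t < real D - 1 \<Longrightarrow> w t * (real D - 1 - t) < w (t + 1) * (t + real D)"
  shows "integral {0..real D} (\<lambda>t. w t * central_prod D t) \<noteq> 0"
proof -
  define g where "g t = w t * central_prod D t" for t
  define s :: "nat \<Rightarrow> real" where "s k = (-1) ^ (D + k + 1)" for k
  define a where "a k = integral {real k..real k + 1} g" for k
  have contg: "continuous_on S g" for S
    unfolding g_def central_prod_def
    by (intro continuous_intros continuous_on_subset[OF cont]) auto
  have contgs: "continuous_on S (\<lambda>t. s k * g (t + c))" for S k c
    by (intro continuous_intros continuous_on_compose2[OF contg[of UNIV]]) auto
  have sa: "s k * a k = integral {0..1} (\<lambda>t. s k * g (t + real k))" for k
    using integral_shift_Icc_real[of 0 1 g "real k"] by (simp add: a_def comp_def add.commute)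
  have sgpos: "0 < s k * central_prod D (t + real k)" if "k < D" "0 < t" "t < 1" for k t
    unfolding s_def using central_prod_sign[OF that] .
  have apos: "0 < s k * a k" if k: "k < D" for k
  proof -
    have "integral {0..1} (\<lambda>t::real. 0::real) < integral {0..1} (\<lambda>t. s k * g (t + real k))"
    \<comment> \<open>Strict inequality is asked for in the open interval only; at t = 0 the
      integrand vanishes.\<close>
    proof (rule integral_less_real)
      fix t :: real assume "t \<in> {0<..<1}"
      then have t: "0 < t" "t < 1" by auto
      have "real k + 1 \<le> real D" using k by linarith
      then have "0 < w (t + real k)" using pos t by simp
      from mult_pos_pos[OF this sgpos[OF k t]] show "0 < s k * g (t + real k)"
        by (simp add: g_def mult_ac)
    qed (use contgs in auto)
    then show ?thesis by (simp add: sa)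
  qed
  have agrow: "s k * a k < s (Suc k) * a (Suc k)" if k: "Suc k < D" for k
    unfolding sa
  proof (rule integral_less_real)
    fix t :: real assume "t \<in> {0<..<1}"
    then have t: "0 < t" "t < 1" by auto
    let ?r = "t + real k"
    have r: "0 < ?r" "?r < real D - 1" using k t by auto
    define u where "u = s k * central_prod D ?r"
    define u' where "u' = s (Suc k) * central_prod D (?r + 1)"
    have u: "0 < u" using sgpos[of k t] k t by (simp add: u_def)
    have u': "u' * (real D - 1 - ?r) = u * (?r + real D)"
      using central_prod_shift[of D ?r] assms(1)
      unfolding u_def u'_def s_def by (simp add: algebra_simps)
    have "(w ?r * u) * (real D - 1 - ?r) < w (?r + 1) * (u * (?r + real D))"
      using mult_strict_right_mono[OF grow[OF r] u] by (simp only: mult_ac)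
    also have "\<dots> = (w (?r + 1) * u') * (real D - 1 - ?r)"
      by (simp only: u'[symmetric] mult.assoc)
    finally have "w ?r * u < w (?r + 1) * u'" using r by (simp add: mult_less_cancel_right)
    then show "s k * g (t + real k) < s (Suc k) * g (t + real (Suc k))"
      by (simp add: u_def u'_def g_def mult_ac add_ac)
  qed (use contgs in auto)
  have abs_a: "\<bar>a k\<bar> = s k * a k" if "k < D" for k
    using apos[OF that] by (auto simp: s_def abs_if mult_less_0_iff minus_one_power_iff split: if_splits)
  have "(\<Sum>k<D. a k) \<noteq> 0"
  proof (rule sum_alternating_growing_nonzero)
    show "a 0 \<noteq> 0" using apos[of 0] assms(1) by auto
    show "\<bar>a k\<bar> < \<bar>a (Suc k)\<bar>" if "Suc k < D" for k
      using that agrow abs_a[of k] abs_a[of "Suc k"] by simp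
    show "a k * a (Suc k) < 0" if "Suc k < D" for k
    proof -
      have "0 < (s k * a k) * (s (Suc k) * a (Suc k))"
        by (rule mult_pos_pos) (use that apos in auto)
      also have "\<dots> = - (a k * a (Suc k))"
        by (simp add: s_def minus_one_power_iff)
      finally show ?thesis by simp
    qed
  qed (use assms(1) in auto)
  then show ?thesis
    using integral_sum_unit_intervals[OF contg, of D] by (simp add: a_def g_def[abs_def])
qed

lemma integral_quadratic_central_prod_nonzero:
  assumes "0 < D"
  shows "integral {0..real D} (\<lambda>t. t * (real D - t) * central_prod D t) \<noteq> 0"
    and "integral {0..real D} (\<lambda>t. ((real D)\<^sup>2 - t\<^sup>2) * central_prod D t) \<noteq> 0"
proof -
  let ?d = "real D"
  show "integral {0..?d} (\<lambda>t. t * (?d - t) * central_prod D t) \<noteq> 0"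
  proof (rule integral_weight_central_prod_nonzero[OF assms])
    fix t assume t: "0 < t" "t < ?d - 1"
    \<comment> \<open>This product is the right side minus the left side of the growth condition,
      factored; the other weight is treated likewise.\<close>
    have "0 < (?d - 1 - t) * (2 * t\<^sup>2 + t + ?d)" using t by (intro mult_pos_pos) (auto intro!: add_pos_pos)
    then show "t * (?d - t) * (?d - 1 - t) < (t + 1) * (?d - (t + 1)) * (t + ?d)"
      by (simp add: algebra_simps power2_eq_square)
  qed (auto intro!: continuous_intros)
  show "integral {0..?d} (\<lambda>t. (?d\<^sup>2 - t\<^sup>2) * central_prod D t) \<noteq> 0"
  proof (rule integral_weight_central_prod_nonzero[OF assms])
    fix t assume t: "0 < t" "t < ?d - 1"
    have "0 < (?d - 1 - t) * (?d + t) * (2 * t + 1)" using t by (intro mult_pos_pos) auto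
    then show "(?d\<^sup>2 - t\<^sup>2) * (?d - 1 - t) < (?d\<^sup>2 - (t + 1)\<^sup>2) * (t + ?d)"
      by (simp add: algebra_simps power2_eq_square)
  qed (auto intro!: continuous_intros power_strict_mono)
qed

subsection \<open>Vanishing at equidistant nodes\<close>

lemma prod_linear_dvd:
  fixes p :: "'a :: idom poly"
  assumes "finite I" "inj_on f I" "\<And>i. i \<in> I \<Longrightarrow> poly p (f i) = 0"
  shows "(\<Prod>i\<in>I. [:- f i, 1:]) dvd p"
  using assms
proof (induction I arbitrary: p rule: finite_induct)
  case (insert i I)
  then obtain q where q: "p = [:- f i, 1:] * q"
    by (metis poly_eq_0_iff_dvd dvdE insertI1)
  have "poly q (f j) = 0" if "j \<in> I" for j
  proof -
    have "f j \<noteq> f i" using insert.prems(1) insert.hyps(2) that by (metis inj_onD insertCI)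
    moreover have "poly p (f j) = 0" using insert.prems(2) that by blast
    ultimately show ?thesis unfolding q by simp
  qed
  then have "(\<Prod>i\<in>I. [:- f i, 1:]) dvd q" using insert.prems(1) by (intro insert.IH) auto
  then show ?case
    unfolding q prod.insert[OF insert.hyps] by (rule mult_dvd_mono[OF dvd_refl])
qed simp

lemma degree_le_1_eq: "degree p \<le> 1 \<Longrightarrow> p = [:coeff p 0, coeff p 1:]"
  by (rule poly_eqI) (auto simp: coeff_pCons coeff_eq_0 split: nat.splits)

text \<open>To be applied with F1(t) = Phi_1(t/D) and F2(t) = D Phi_2(t/D). The Bernoulli
  polynomials enter only through \<open>shift\<close> and the two integrals.\<close>

lemma consecutive_pair_zero:
  fixes F1 F2 :: "real poly"
  assumes "0 < D"
    and deg1: "degree F1 \<le> 2 * D" and deg2: "degree F2 \<le> 2 * D + 1"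
    and zero1: "\<And>i. i < D \<Longrightarrow> poly F1 (real i) = 0"
    and zero2: "\<And>i. i < D \<Longrightarrow> poly F2 (real i) = 0"
    and shift: "\<And>t. poly F2 (t + real D) - poly F2 t = t * (poly F1 (t + real D) - poly F1 t)"
    and int1: "integral {0..real D} (poly F1) = 0"
    and int2: "integral {0..real D} (poly F2) = 0"
  shows "F1 = 0 \<and> F2 = 0"
proof -
  define P :: "real poly" where "P = (\<Prod>i<D. [:- real i, 1:])"
  define Q :: "real poly" where "Q = (\<Prod>i<D. [:- (real i - real D), 1:])"
  have polyP: "poly P t = (\<Prod>i<D. t - real i)" for t
    by (simp add: P_def poly_prod)
  have polyQ: "poly Q t = poly P (t + real D)" for t
    by (simp add: P_def Q_def poly_prod algebra_simps)
  have nz: "P \<noteq> 0" "Q \<noteq> 0" and deg: "degree P = D" "degree Q = D"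
    by (auto simp: P_def Q_def degree_prod_sum_eq)
  have "P dvd F1" "P dvd F2"
    unfolding P_def by (rule prod_linear_dvd; auto simp: inj_on_def zero1 zero2)+
  then obtain A C where F1: "F1 = P * A" and F2: "F2 = P * C" by (auto elim!: dvdE)
  have degA: "degree A \<le> D"
    using deg1 deg nz by (cases "A = 0") (auto simp: F1 degree_mult_eq)
  have degC: "degree C \<le> D + 1"
    using deg2 deg nz by (cases "C = 0") (auto simp: F2 degree_mult_eq)
  \<comment> \<open>Inserting F1 = P A and F2 = P C into \<open>shift\<close> and sorting by P(t)
    and P(t + D) = Q(t) gives Q U = P V.\<close>
  define V where "V = C - [:0, 1:] * A"
  define U where "U = pcompose C [:real D, 1:] - [:0, 1:] * pcompose A [:real D, 1:]"
  have polyU: "poly U t = poly C (t + real D) - t * poly A (t + real D)" for t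
    by (simp add: U_def poly_pcompose add.commute)
  have "poly (Q * U) t = poly (P * V) t" for t
    using shift[of t] by (simp add: F1 F2 polyQ polyU V_def algebra_simps)
  then have QU: "Q * U = P * V" by (simp add: poly_eq_poly_eq_iff[symmetric] fun_eq_iff)
  have "Q dvd V"
    unfolding Q_def
  proof (rule prod_linear_dvd)
    fix i assume i: "i \<in> {..<D}"
    \<comment> \<open>The zeros of Q are the integers -D, ..., -1, where P does not vanish; hence
      they are zeros of V.\<close>
    have "poly Q (real i - real D) = 0"
      using i by (auto simp: Q_def poly_prod)
    then have "poly P (real i - real D) * poly V (real i - real D) = 0"
      by (metis QU poly_mult mult_zero_left)
    moreover have "poly P (real i - real D) \<noteq> 0"
      using i by (auto simp: polyP)
    ultimately show "poly V (real i - real D) = 0" by simp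
  qed (auto simp: inj_on_def)
  then obtain E where V: "V = Q * E" by (auto elim!: dvdE)
  have "Q * U = Q * (P * E)" using QU V by (simp add: mult_ac)
  then have U: "U = P * E" using nz by simp
  have "degree V \<le> D + 1"
    unfolding V_def
    by (rule degree_diff_le[OF degC order.trans[OF degree_mult_le]]) (use degA in auto)
  then have "degree E \<le> 1"
    using deg nz by (cases "E = 0") (auto simp: V degree_mult_eq)
  then obtain e0 e1 where E: "E = [:e0, e1:]" using degree_le_1_eq by blast
  define R where "R = central_prod D"
  define N where "N t = (t + real D) * R t * (e0 + e1 * t)" for t
  have N: "N t = poly P t * poly P (t + real D) * poly E t" for t
    using falling_prod_mult_shift[OF assms(1), of t]
    by (simp add: N_def R_def E polyP algebra_simps)
  have eqV: "poly C t - t * poly A t = poly P (t + real D) * poly E t" for t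
    using arg_cong[where f = "\<lambda>p. poly p t", OF V] by (simp add: V_def polyQ)
  have eqU: "poly C t - (t - real D) * poly A t = poly P (t - real D) * poly E (t - real D)" for t
    using arg_cong[where f = "\<lambda>p. poly p (t - real D)", OF U] by (simp add: polyU)
  \<comment> \<open>Subtracting \<open>eqV\<close> from \<open>eqU\<close> eliminates C.\<close>
  have DA: "real D * poly A t = poly P (t - real D) * poly E (t - real D) - poly P (t + real D) * poly E t" for t
    using eqU[of t] eqV[of t] by (simp add: algebra_simps)
  have F1N: "real D * poly F1 t = N (t - real D) - N t" for t
  proof -
    have "real D * poly F1 t = poly P t * (real D * poly A t)" by (simp add: F1)
    then show ?thesis unfolding DA by (simp add: N algebra_simps)
  qed
  have F2N: "real D * poly F2 t = t * N (t - real D) - (t - real D) * N t" for t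
  proof -
    have "real D * poly F2 t = t * (real D * poly F1 t) + real D * (poly P t * (poly C t - t * poly A t))"
      by (simp add: F1 F2 algebra_simps)
    also have "\<dots> = t * (N (t - real D) - N t) + real D * N t"
      unfolding F1N eqV by (simp add: N)
    finally show ?thesis by (simp add: algebra_simps)
  qed
  have contR: "continuous_on S R" for S
    unfolding R_def central_prod_def by (intro continuous_intros)
  have contN: "continuous_on S N" for S
    unfolding N_def by (intro continuous_intros contR)
  have contN': "continuous_on S (\<lambda>t. N (c - t))" "continuous_on S (\<lambda>t. N (- t))"
    "continuous_on S (\<lambda>t. N (t - c))" for S c
    by (intro continuous_on_compose2[OF contN[of UNIV]] continuous_intros; simp)+
  let ?I = "{0..real D}"
  have Rm: "R (- t) = - R t" for t by (simp add: R_def central_prod_uminus)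
  have i1: "integral ?I (\<lambda>t. (e0 * real D + e1 * t\<^sup>2) * R t) = 0"
  proof -
    have "0 = integral ?I (\<lambda>t. real D * poly F1 t)" using int1 by simp
    also have "\<dots> = integral ?I (\<lambda>t. N (t - real D)) - integral ?I N"
      unfolding F1N by (intro integral_diff integrable_continuous_interval contN contN')
    \<comment> \<open>The reflection t -> D - t turns N(t - D) into N(-t); oddness of R then leaves
      only the even part of (t + D)(e0 + e1 t).\<close>
    also have "integral ?I (\<lambda>t. N (t - real D)) = integral ?I (\<lambda>t. N (- t))"
      using integral_reflect_interval[OF contN'(2), of "real D"] by simp
    also have "\<dots> - integral ?I N = integral ?I (\<lambda>t. N (- t) - N t)"
      by (intro integral_diff[symmetric] integrable_continuous_interval contN contN')
    also have "(\<lambda>t. N (- t) - N t) = (\<lambda>t. - 2 * ((e0 * real D + e1 * t\<^sup>2) * R t))"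
      by (simp add: N_def Rm algebra_simps power2_eq_square)
    finally show ?thesis by simp
  qed
  have i2: "(e0 + real D * e1) * integral ?I (\<lambda>t. t * (real D - t) * R t) = 0"
  proof -
    have "0 = integral ?I (\<lambda>t. real D * poly F2 t)" using int2 by simp
    also have "\<dots> = integral ?I (\<lambda>t. t * N (t - real D)) - integral ?I (\<lambda>t. (t - real D) * N t)"
      unfolding F2N by (intro integral_diff integrable_continuous_interval contN contN' continuous_intros)
    also have "integral ?I (\<lambda>t. t * N (t - real D)) = integral ?I (\<lambda>t. (real D - t) * N (- t))"
      using integral_reflect_interval[of "real D" "\<lambda>t. (real D - t) * N (- t)"]
      by (simp add: contN' continuous_intros)
    also have "\<dots> - integral ?I (\<lambda>t. (t - real D) * N t) = integral ?I (\<lambda>t. (real D - t) * N (- t) - (t - real D) * N t)"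
      by (intro integral_diff[symmetric] integrable_continuous_interval contN contN' continuous_intros)
    also have "(\<lambda>t. (real D - t) * N (- t) - (t - real D) * N t)
        = (\<lambda>t. (2 * (e0 + real D * e1)) * (t * (real D - t) * R t))"
      by (simp add: N_def Rm algebra_simps power2_eq_square fun_eq_iff)
    finally have "2 * (e0 + real D * e1) * integral ?I (\<lambda>t. t * (real D - t) * R t) = 0"
      by (simp only: integral_mult_right)
    then show ?thesis by auto
  qed
  then have e0: "e0 = - real D * e1"
    using integral_quadratic_central_prod_nonzero(1)[OF assms(1)] by (simp add: R_def)
  \<comment> \<open>With e0 = -D e1 the weight in the first condition becomes a multiple of D^2 -
    t^2, the second weight with nonzero integral.\<close>
  have "(\<lambda>t. (e0 * real D + e1 * t\<^sup>2) * R t) = (\<lambda>t. (- e1) * (((real D)\<^sup>2 - t\<^sup>2) * R t))"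
    by (simp add: e0 algebra_simps power2_eq_square fun_eq_iff)
  with i1 have "(- e1) * integral ?I (\<lambda>t. ((real D)\<^sup>2 - t\<^sup>2) * R t) = 0" by simp
  then have e1: "e1 = 0"
    using integral_quadratic_central_prod_nonzero(2)[OF assms(1)] by (simp add: R_def)
  have "N t = 0" for t by (simp add: N_def e0 e1)
  then have "real D * poly F1 t = 0" "real D * poly F2 t = 0" for t
    unfolding F1N F2N by simp_all
  then have "poly F1 t = 0" "poly F2 t = 0" for t using assms(1) by auto
  then show ?thesis using poly_all_0_iff_0 by blast
qed

subsection \<open>Bernoulli sums and the determinant\<close>

text \<open>The antiderivative D B_(n+1)(t/D)/(n+1) agrees at both ends because B_(n+1)(1) -
  B_(n+1)(0) = (n+1) 0^n, which is 0 for n > 0.\<close>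

lemma integral_bern_scaled:
  assumes "0 < D" "0 < n"
  shows "((\<lambda>t. bernpoly n (t / real D)) has_integral 0) {0..real D}"
proof -
  let ?H = "\<lambda>t. real D / real (Suc n) * poly (bern (Suc n)) (t / real D)"
  have "((\<lambda>t. bernpoly n (t / real D)) has_integral (?H (real D) - ?H 0)) {0..real D}"
  proof (rule fundamental_theorem_of_calculus)
    fix t assume "t \<in> {0..real D}"
    have "((\<lambda>t. poly (bern (Suc n)) (t / real D)) has_real_derivative
        poly (pderiv (bern (Suc n))) (t / real D) * (1 / real D)) (at t)"
      using assms(1) by (intro DERIV_chain2[OF poly_DERIV]) (auto intro!: derivative_eq_intros)
    from DERIV_cmult[OF this, of "real D / real (Suc n)"]
    have "(?H has_real_derivative bernpoly n (t / real D)) (at t)"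
      using assms(1) by (simp add: pderiv_bern poly_bern del: of_nat_Suc)
    then show "(?H has_vector_derivative bernpoly n (t / real D)) (at t within {0..real D})"
      by (simp add: has_real_derivative_iff_has_vector_derivative has_vector_derivative_at_within)
  qed simp
  moreover have "bernpoly (Suc n) 1 = bernpoly (Suc n) 0"
    using bernpoly_diff[of n 0] assms(2) by (simp add: zero_power)
  ultimately show ?thesis using assms(1) by (simp add: poly_bern)
qed

text \<open>The denominators k + j - 1 cancel the factors from the Bernoulli difference equation, so
  the increment has the bare coefficients b_k.\<close>

lemma Phi_diff:
  assumes "1 \<le> j"
  shows "Phi D b j (x + 1) - Phi D b j x = (\<Sum>k=1..2*D. b k * x ^ (k + j - 2))"
  unfolding Phi_def sum_subtractf[symmetric]
proof (intro sum.cong refl)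
  fix k assume "k \<in> {1..2 * D}"
  then obtain n where n: "k + j - 1 = Suc n" "k + j - 2 = n"
    using assms by (intro that[of "k + j - 2"]) auto
  show "b k * (bernpoly (k + j - 1) (x + 1) / real (k + j - 1)) - b k * (bernpoly (k + j - 1) x / real (k + j - 1))
      = b k * x ^ (k + j - 2)"
    unfolding n right_diff_distrib[symmetric] diff_divide_distrib[symmetric] bernpoly_diff by simp
qed

lemma integral_Phi_scaled:
  assumes "0 < D" "1 \<le> j"
  shows "integral {0..real D} (\<lambda>t. Phi D b j (t / real D)) = 0"
proof -
  have "((\<lambda>t. Phi D b j (t / real D)) has_integral (\<Sum>k=1..2*D. b k * (0 / real (k + j - 1)))) {0..real D}"
    unfolding Phi_def
    by (intro has_integral_sum has_integral_mult_right has_integral_divide integral_bern_scaled)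
       (use assms in auto)
  then show ?thesis by (simp add: integral_unique)
qed

lemma Phi_scaled_poly:
  "\<exists>F. (\<forall>t. poly F t = Phi D b j (t / real D)) \<and> degree F \<le> 2 * D + j - 1"
proof (intro exI conjI allI)
  let ?F = "\<Sum>k=1..2*D. smult (b k / real (k + j - 1)) (pcompose (bern (k + j - 1)) [:0, 1 / real D:])"
  show "poly ?F t = Phi D b j (t / real D)" for t
    by (simp add: Phi_def poly_sum poly_pcompose poly_bern)
  show "degree ?F \<le> 2 * D + j - 1"
  proof (rule degree_sum_le)
    fix k assume "k \<in> {1..2 * D}"
    have "degree (smult (b k / real (k + j - 1)) (pcompose (bern (k + j - 1)) [:0, 1 / real D:]))
        \<le> degree (bern (k + j - 1)) * degree [:0, 1 / real D:]"
      by (rule order.trans[OF degree_smult_le degree_pcompose_le])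
    also have "\<dots> \<le> (k + j - 1) * 1"
      by (rule mult_le_mono[OF degree_bern]) simp
    also have "\<dots> \<le> 2 * D + j - 1" using \<open>k \<in> {1..2 * D}\<close> by auto
    finally show "degree (smult (b k / real (k + j - 1)) (pcompose (bern (k + j - 1)) [:0, 1 / real D:])) \<le> 2 * D + j - 1" .
  qed simp
qed

lemma Phi_eq_zero:
  assumes "0 < D" and zero: "\<forall>j\<in>{1, 2}. \<forall>i<D. Phi D b j (real i / real D) = 0"
  shows "Phi D b 1 = (\<lambda>x. 0)" "Phi D b 2 = (\<lambda>x. 0)"
proof -
  obtain F1 where F1: "\<And>t. poly F1 t = Phi D b 1 (t / real D)" "degree F1 \<le> 2 * D + 1 - 1"
    using Phi_scaled_poly[of D b 1] by blast
  obtain G where G: "\<And>t. poly G t = Phi D b 2 (t / real D)" "degree G \<le> 2 * D + 2 - 1"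
    using Phi_scaled_poly[of D b 2] by blast
  have "F1 = 0 \<and> smult (real D) G = 0"
  proof (rule consecutive_pair_zero[OF assms(1)])
    fix t
    have *: "(t + real D) / real D = t / real D + 1" using assms(1) by (simp add: field_simps)
    \<comment> \<open>Raising j by one multiplies every term of the increment by x = t/D; the factor
      D on \<open>G\<close> turns this into t.\<close>
    have "Phi D b 2 (t / real D + 1) - Phi D b 2 (t / real D)
        = t / real D * (Phi D b 1 (t / real D + 1) - Phi D b 1 (t / real D))"
      unfolding Phi_diff[OF order.refl] Phi_diff[of 2, OF one_le_numeral] sum_distrib_left
      by (intro sum.cong refl) (auto simp: power_eq_if mult_ac)
    then show "poly (smult (real D) G) (t + real D) - poly (smult (real D) G) t
        = t * (poly F1 (t + real D) - poly F1 t)"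
      unfolding poly_smult F1 G * right_diff_distrib[symmetric] using assms(1) by simp
  next
    show "integral {0..real D} (poly F1) = 0"
      using integral_Phi_scaled[OF assms(1), of 1 b] by (simp add: F1(1)[abs_def])
    show "integral {0..real D} (poly (smult (real D) G)) = 0"
      using integral_Phi_scaled[OF assms(1), of 2 b] by (simp add: poly_smult[abs_def] G(1))
  qed (use F1(2) G(2) zero in \<open>auto simp: F1(1) G(1)\<close>)
  then have "F1 = 0" "G = 0" using assms(1) by auto
  then have "Phi D b 1 (real D * x / real D) = 0" "Phi D b 2 (real D * x / real D) = 0" for x
    using F1(1) G(1) by (metis poly_0)+
  then show "Phi D b 1 = (\<lambda>x. 0)" "Phi D b 2 = (\<lambda>x. 0)" using assms(1) by (auto simp: fun_eq_iff)
qed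

section \<open>Recovering coefficients and the determinant\<close>

lemma coeff_zero_of_Phi_zero:
  assumes "Phi D b 1 = (\<lambda>x. 0)" "n < 2 * D"
  shows "b (Suc n) = 0"
proof -
  let ?p = "\<Sum>k<2*D. monom (b (Suc k)) k"
  \<comment> \<open>The left side is the increment of Phi_1 over a unit step, now indexed from 0 as
    a polynomial with coefficients b_1, ..., b_(2D).\<close>
  have "(\<Sum>k=1..2*D. b k * x ^ (k + 1 - 2)) = (\<Sum>k<2*D. b (Suc k) * x ^ k)" for x
    by (rule sum.reindex_bij_witness[of _ Suc "\<lambda>k. k - 1"]) auto
  then have "poly ?p x = 0" for x
    using Phi_diff[of 1 D b x] by (simp add: assms(1)[unfolded One_nat_def] poly_sum poly_monom)
  then have "?p = 0" using poly_all_0_iff_0[of ?p] by blast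
  moreover have "coeff ?p n = b (Suc n)" using assms(2) by (simp add: coeff_sum)
  ultimately show ?thesis by simp
qed

text \<open>The coefficients (-D)^n v_n absorb the row factor D^n, and their sign turns the
  reflection sign (-1)^(n+m+1) into (-1)^(m+1), which is the same for all rows.\<close>

lemma Phi_of_left_combination:
  assumes "0 < D" "i < D"
  shows "real D ^ m * Phi D (\<lambda>k. v (k - 1) * (- real D) ^ (k - 1)) (m + 1) (real i / real D)
    = (-1) ^ (m + 1) * (\<Sum>n<2*D. real D ^ (n + m) * (bernpoly (n + m + 1) (real (D - i) / real D) / real (n + m + 1)) * v n)"
proof -
  have reflect: "bernpoly (n + m + 1) (real i / real D) = (-1) ^ (n + m + 1) * bernpoly (n + m + 1) (real (D - i) / real D)" for n
    using bernpoly_reflect[of "n + m + 1" "real (D - i) / real D"] assms by (simp add: diff_divide_distrib)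
  have ac: "dm * (w * (e * dn) * ((e' * B) / q)) = (e * e') * (dn * dm * (B / q) * w)"
    for dm w e dn e' B q :: real
    by simp
  have Phi: "Phi D (\<lambda>k. v (k - 1) * (- real D) ^ (k - 1)) (m + 1) (real i / real D)
      = (\<Sum>n<2*D. v n * (- real D) ^ n * (bernpoly (n + m + 1) (real i / real D) / real (n + m + 1)))"
    unfolding Phi_def by (rule sum.reindex_bij_witness[of _ Suc "\<lambda>k. k - 1"]) auto
  show ?thesis
    unfolding Phi sum_distrib_left
  proof (intro sum.cong refl)
    fix n
    have "(-1::real) ^ n * (-1) ^ (n + m + 1) = (-1) ^ (m + 1)"
      by (simp add: minus_one_power_iff)
    then show "real D ^ m * (v n * (- real D) ^ n * (bernpoly (n + m + 1) (real i / real D) / real (n + m + 1)))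
        = (-1) ^ (m + 1) * (real D ^ (n + m) * (bernpoly (n + m + 1) (real (D - i) / real D) / real (n + m + 1)) * v n)"
      unfolding reflect power_minus[of "real D"] power_add[of "real D"] by (simp only: ac)
  qed
qed

lemma Delta_2_nonzero:
  assumes "0 < D"
  shows "Delta 2 D \<noteq> 0"
proof
  assume "Delta 2 D = 0"
  define M where "M = Delta_mat 2 D"
  have M: "M \<in> carrier_mat (2 * D) (2 * D)" by (simp add: M_def Delta_mat_def)
  \<comment> \<open>Transposing yields a relation between the rows, whose index n carries the
    coefficients of \<open>Phi\<close>.\<close>
  have "det (transpose_mat M) = 0"
    using \<open>Delta 2 D = 0\<close> det_transpose[OF M] by (simp add: Delta_def M_def)
  moreover have "transpose_mat M \<in> carrier_mat (2 * D) (2 * D)" using M by simp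
  ultimately obtain v where v: "v \<in> carrier_vec (2 * D)" "v \<noteq> 0\<^sub>v (2 * D)"
      "transpose_mat M *\<^sub>v v = 0\<^sub>v (2 * D)"
    using det_0_iff_vec_prod_zero_field by blast
  have col: "(\<Sum>n<2*D. M $$ (n, c) * vec_index v n) = 0" if "c < 2 * D" for c
  proof -
    have "vec_index (transpose_mat M *\<^sub>v v) c = 0" using v(3) that by simp
    then show ?thesis
      using that M v(1) by (auto simp: scalar_prod_def lessThan_atLeast0)
  qed
  define b where "b k = vec_index v (k - 1) * (- real D) ^ (k - 1)" for k
  have Phi0: "Phi D b (m + 1) (real i / real D) = 0" if m: "m < 2" and i: "i < D" for m i
  proof -
    \<comment> \<open>Within block m, the 0-based position e = D - 1 - i belongs to the node (D -
      i)/D, the reflection of i/D.\<close>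
    obtain e where e: "e < D" "e + 1 = D - i"
      using i by (intro that[of "D - 1 - i"]) auto
    let ?c = "m * D + e"
    have c: "?c div D = m" "?c mod D + 1 = D - i" using e by auto
    have "m * D \<le> 1 * D" using m by (intro mult_le_mono1) simp
    then have cl: "?c < 2 * D" using e by linarith
    have "M $$ (n, ?c) = real D ^ (n + m) * (bernpoly (n + m + 1) (real (D - i) / real D) / real (n + m + 1))"
      if "n < 2 * D" for n
      unfolding M_def Delta_mat_def using that cl
      by (subst index_mat) (auto simp only: Let_def c split_conv)
    with col[OF cl] have "real D ^ m * Phi D b (m + 1) (real i / real D) = 0"
      unfolding b_def[abs_def] Phi_of_left_combination[OF assms i] by simp
    then show ?thesis using assms by simp
  qed
  have "\<forall>j\<in>{1, 2}. \<forall>i<D. Phi D b j (real i / real D) = 0"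
    using Phi0[of 0] Phi0[of 1] by (auto simp: numeral_2_eq_2)
  from Phi_eq_zero(1)[OF assms this] have "Phi D b 1 = (\<lambda>x. 0)" .
  then have "b (Suc n) = 0" if "n < 2 * D" for n
    using that by (rule coeff_zero_of_Phi_zero)
  then have "vec_index v n = 0" if "n < 2 * D" for n
    using that assms by (simp add: b_def)
  then have "v = 0\<^sub>v (2 * D)" using v(1) by (intro eq_vecI) auto
  with v(2) show False by contradiction
qed

theorem corollary2p12:
  fixes D :: nat
  assumes "D \<ge> 1"
  shows "(\<forall>b :: nat \<Rightarrow> real.
            (\<forall>j\<in>{1, 2}. \<forall>i<D. Phi D b j (real i / real D) = 0)
              \<longrightarrow> Phi D b 1 = (\<lambda>x. 0) \<and> Phi D b 2 = (\<lambda>x. 0))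
         \<and> Delta 2 D \<noteq> 0"
proof (intro conjI allI impI)
  have D: "0 < D" using assms by simp
  show "Delta 2 D \<noteq> 0" by (rule Delta_2_nonzero[OF D])
  fix b :: "nat \<Rightarrow> real"
  assume "\<forall>j\<in>{1, 2}. \<forall>i<D. Phi D b j (real i / real D) = 0"
  from Phi_eq_zero[OF D this] show "Phi D b 1 = (\<lambda>x. 0)" "Phi D b 2 = (\<lambda>x. 0)" by simp_all
qed

end
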